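(* Let $p$ be an odd prime with $p \equiv 1 \pmod 4$, let $m \geq 0$ be an integer, and let $t \in \mathbb{Z}_p$. Then $$ N_{2m+1}(t, p) = \begin{cases} p^{2m} & \text{if } t = 0, \\ p^{2m} - p^m & \text{if } t \text{ is a non-residue} \pmod p, \\ p^{2m} + p^m & \text{if } t \text{ is a residue} \pmod p. \end{cases} $$
   Context: $\mathbb{Z}_p$ denotes the ring of integers modulo $p$. For $t \in \mathbb{Z}_p$, $N_j(t,p)$ is the number of ordered $j$-tuples $(x_1,\dots,x_j) \in \mathbb{Z}_p^j$ with $\sum_{i=1}^j x_i^2 = t$ in $\mathbb{Z}_p$ (zero entries are allowed). "Residue" means a nonzero square in $\mathbb{Z}_p$ and "non-residue" means an element of $\mathbb{Z}_p$ that is not a square. *)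

theory Defs
  imports "HOL-Number_Theory.Residues"
begin

(* The ring Z_p is the library's residue_ring (int p), with carrier {0..p - 1}.
   A j-tuple over Z_p is an extensional function on the index set {1..j}; for j = 0 there is
   exactly one tuple (the empty one), with sum zero. *)

definition num_sum_squares :: "nat \<Rightarrow> int \<Rightarrow> nat \<Rightarrow> nat" where
  "num_sum_squares j t p =
     card {x \<in> {1..j} \<rightarrow>\<^sub>E carrier (residue_ring (int p)).
             (\<Oplus>\<^bsub>residue_ring (int p)\<^esub> i\<in>{1..j}. x i [^]\<^bsub>residue_ring (int p)\<^esub> (2::nat)) = t}"

(* QuadRes p 0 holds, so zero has to be excluded explicitly: a residue is a nonzero square,
   and zero is neither a residue nor a non-residue. *)

definition is_residue :: "nat \<Rightarrow> int \<Rightarrow> bool" where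
  "is_residue p t \<longleftrightarrow> t \<in> carrier (residue_ring (int p)) \<and>
     t \<noteq> \<zero>\<^bsub>residue_ring (int p)\<^esub> \<and> QuadRes (int p) t"

definition is_nonresidue :: "nat \<Rightarrow> int \<Rightarrow> bool" where
  "is_nonresidue p t \<longleftrightarrow> t \<in> carrier (residue_ring (int p)) \<and> \<not> QuadRes (int p) t"

end

theory Submission
  imports Defs "HOL-Number_Theory.Euler_Criterion"
begin

text \<open>
  For \<open>p \<equiv> 1 (mod 4)\<close> there is an integer \<open>\<iota>\<close> with \<open>\<iota>\<^sup>2 \<equiv> -1\<close>, so over \<open>\<int>\<^sub>p\<close> the form
  \<open>a\<^sup>2 + b\<^sup>2 = (a + \<iota> b) (a - \<iota> b)\<close> is a hyperbolic plane: the linear substitution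
  \<open>u = a + \<iota> b\<close>, \<open>v = a - \<iota> b\<close> is invertible because \<open>2\<close> and \<open>\<iota>\<close> are units. Splitting two
  squares off a sum of \<open>j + 2\<close> squares therefore gives
  \<open>N\<^sub>j\<^sub>+\<^sub>2(t) = \<Sum>\<^sub>u \<Sum>\<^sub>v N\<^sub>j(t - u v)\<close>. The terms with \<open>u = 0\<close> contribute \<open>p N\<^sub>j(t)\<close>. For each of
  the \<open>p - 1\<close> other values of \<open>u\<close>, the argument \<open>t - u v\<close> runs once through \<open>\<int>\<^sub>p\<close>, so the inner
  sum is the number \<open>p\<^sup>j\<close> of all \<open>j\<close>-tuples. This is the recursion
  \<open>N\<^sub>j\<^sub>+\<^sub>2(t) = p N\<^sub>j(t) + (p - 1) p\<^sup>j\<close> proved in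
  \<open>num_sum_squares_add_2\<close>.

  The deviation of \<open>N\<^sub>j(t)\<close> from the average value \<open>p\<^sup>j\<^sup>-\<^sup>1\<close> is thus multiplied by \<open>p\<close> in each
  step. For \<open>j = 1\<close> it is \<open>0\<close>, \<open>-1\<close> or \<open>1\<close> according as \<open>t\<close> is zero, a non-residue or a residue,
  since \<open>t\<close> then has \<open>1\<close>, \<open>0\<close> or \<open>2\<close> square roots. After \<open>m\<close> steps it is \<open>0\<close>, \<open>-p\<^sup>m\<close> or \<open>p\<^sup>m\<close>.
\<close>

section \<open>Counting tuples with integer arithmetic\<close>

lemma carrier_residue_ring: "carrier (residue_ring (int p)) = {0..<int p}"
  by (auto simp: residue_ring_def)

lemma finsum_squares_residue_ring:
  assumes "prime p" and "finite A" and "x \<in> A \<rightarrow> {0..<int p}"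
  shows "(\<Oplus>\<^bsub>residue_ring (int p)\<^esub> i\<in>A. x i [^]\<^bsub>residue_ring (int p)\<^esub> (2::nat))
           = (\<Sum>i\<in>A. (x i)\<^sup>2) mod int p"
proof -
  interpret residues "int p" "residue_ring (int p)"
    using prime_gt_1_nat[OF assms(1)] by unfold_locales auto
  have sq: "a [^]\<^bsub>residue_ring (int p)\<^esub> (2::nat) = a\<^sup>2 mod int p" if "a \<in> {0..<int p}" for a
    using pow_cong[of a 2] that by simp
  from assms(2,3) show ?thesis
  proof (induction A rule: finite_induct)
    case empty
    then show ?case by (simp add: res_zero_eq)
  next
    case (insert k A)
    have mem: "x i [^]\<^bsub>residue_ring (int p)\<^esub> (2::nat) \<in> carrier (residue_ring (int p))"
      if "i \<in> insert k A" for i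
      using insert.prems that carrier_residue_ring
      by (intro nat_pow_closed) (auto simp: Pi_iff)
    have "(\<Oplus>\<^bsub>residue_ring (int p)\<^esub> i\<in>insert k A. x i [^]\<^bsub>residue_ring (int p)\<^esub> (2::nat))
            = x k [^]\<^bsub>residue_ring (int p)\<^esub> (2::nat) \<oplus>\<^bsub>residue_ring (int p)\<^esub>
              (\<Oplus>\<^bsub>residue_ring (int p)\<^esub> i\<in>A. x i [^]\<^bsub>residue_ring (int p)\<^esub> (2::nat))"
      using insert.hyps mem by (intro finsum_insert) auto
    then show ?case
      using insert sq[of "x k"] by (simp add: res_add_eq mod_simps Pi_iff)
  qed
qed

lemma num_sum_squares_eq_card:
  assumes "prime p"
  shows "num_sum_squares j t p =
           card {x \<in> {1..j} \<rightarrow>\<^sub>E {0..<int p}. (\<Sum>i\<in>{1..j}. (x i)\<^sup>2) mod int p = t}"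
proof -
  have "(\<Oplus>\<^bsub>residue_ring (int p)\<^esub> i\<in>{1..j}. x i [^]\<^bsub>residue_ring (int p)\<^esub> (2::nat))
          = (\<Sum>i\<in>{1..j}. (x i)\<^sup>2) mod int p"
    if "x \<in> {1..j} \<rightarrow>\<^sub>E {0..<int p}" for x
    using that by (intro finsum_squares_residue_ring[OF assms]) (auto simp: PiE_iff)
  then show ?thesis
    unfolding num_sum_squares_def carrier_residue_ring
    by (intro arg_cong[of _ _ card] Collect_cong conj_cong) auto
qed

lemma num_sum_squares_0:
  assumes "prime p"
  shows "num_sum_squares 0 t p = (if t = 0 then 1 else 0)"
  unfolding num_sum_squares_eq_card[OF assms] by auto

text \<open>A tuple is determined by its last entry \<open>a\<close> and the remaining entries, whose squares must
  sum to \<open>t - a\<^sup>2\<close>.\<close>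

lemma num_sum_squares_Suc:
  assumes "prime p" and "t \<in> {0..<int p}"
  shows "num_sum_squares (Suc j) t p =
           (\<Sum>a\<in>{0..<int p}. num_sum_squares j ((t - a\<^sup>2) mod int p) p)"
proof -
  define S where "S = (\<lambda>(j::nat) t. {x \<in> {1..j} \<rightarrow>\<^sub>E {0..<int p}. (\<Sum>i\<in>{1..j}. (x i)\<^sup>2) mod int p = t})"
  have fin: "finite (S j s)" for j s
    unfolding S_def by (simp add: finite_PiE)
  have ins: "{1..Suc j} = insert (Suc j) {1..j}"
    by auto
  have split: "(a\<^sup>2 + y) mod int p = t \<longleftrightarrow> y mod int p = (t - a\<^sup>2) mod int p" for a y
  proof -
    have "(a\<^sup>2 + y) mod int p = t \<longleftrightarrow> [a\<^sup>2 + y = t] (mod int p)"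
      using assms(2) by (simp add: cong_def)
    also have "\<dots> \<longleftrightarrow> [y = t - a\<^sup>2] (mod int p)"
      by (simp add: cong_iff_dvd_diff algebra_simps)
    finally show ?thesis by (simp add: cong_def)
  qed
  have upd: "(\<Sum>i\<in>{1..Suc j}. ((y(Suc j := a)) i)\<^sup>2) mod int p = t \<longleftrightarrow>
      (\<Sum>i\<in>{1..j}. (y i)\<^sup>2) mod int p = (t - a\<^sup>2) mod int p" for y :: "nat \<Rightarrow> int" and a
  proof -
    have "(\<Sum>i\<in>{1..Suc j}. ((y(Suc j := a)) i)\<^sup>2) = a\<^sup>2 + (\<Sum>i\<in>{1..j}. (y i)\<^sup>2)"
      unfolding ins by (subst sum.insert) (auto intro!: sum.cong)
    then show ?thesis
      by (simp only: split)
  qed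
  have "bij_betw (\<lambda>(a, y). y(Suc j := a))
          (SIGMA a:{0..<int p}. S j ((t - a\<^sup>2) mod int p)) (S (Suc j) t)"
  proof (rule bij_betw_imageI)
    show "inj_on (\<lambda>(a, y). y(Suc j := a)) (SIGMA a:{0..<int p}. S j ((t - a\<^sup>2) mod int p))"
      by (rule inj_on_subset[OF inj_combinator[of "Suc j" "{1..j}" "\<lambda>_. {0..<int p}"]])
         (auto simp: S_def)
    show "(\<lambda>(a, y). y(Suc j := a)) ` (SIGMA a:{0..<int p}. S j ((t - a\<^sup>2) mod int p)) = S (Suc j) t"
    proof (intro subset_antisym subsetI)
      fix x assume "x \<in> (\<lambda>(a, y). y(Suc j := a)) ` (SIGMA a:{0..<int p}. S j ((t - a\<^sup>2) mod int p))"
      then obtain a y where x: "x = y(Suc j := a)" "a \<in> {0..<int p}" "y \<in> S j ((t - a\<^sup>2) mod int p)"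
        by auto
      then have "x \<in> {1..Suc j} \<rightarrow>\<^sub>E {0..<int p}"
        unfolding ins S_def by (auto simp: PiE_insert_eq)
      with x show "x \<in> S (Suc j) t"
        unfolding S_def by (simp only: mem_Collect_eq upd)
    next
      fix x assume x: "x \<in> S (Suc j) t"
      then have "x \<in> (\<lambda>(a, y). y(Suc j := a)) ` ({0..<int p} \<times> ({1..j} \<rightarrow>\<^sub>E {0..<int p}))"
        unfolding S_def ins PiE_insert_eq by auto
      then obtain a y where y: "x = y(Suc j := a)" "a \<in> {0..<int p}" "y \<in> {1..j} \<rightarrow>\<^sub>E {0..<int p}"
        by auto
      moreover have "y \<in> S j ((t - a\<^sup>2) mod int p)"
        using x y unfolding S_def by (simp only: mem_Collect_eq upd)
      ultimately show "x \<in> (\<lambda>(a, y). y(Suc j := a)) ` (SIGMA a:{0..<int p}. S j ((t - a\<^sup>2) mod int p))"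
        by force
    qed
  qed
  then have "card (S (Suc j) t) = card (SIGMA a:{0..<int p}. S j ((t - a\<^sup>2) mod int p))"
    by (simp add: bij_betw_same_card)
  also have "\<dots> = (\<Sum>a\<in>{0..<int p}. card (S j ((t - a\<^sup>2) mod int p)))"
    by (rule card_SigmaI) (auto intro: fin)
  finally show ?thesis
    unfolding num_sum_squares_eq_card[OF assms(1)] S_def .
qed

section \<open>Sums over the residues modulo a prime\<close>

lemma sum_residues_affine:
  fixes f :: "int \<Rightarrow> 'a::comm_monoid_add" and c u :: int
  assumes "p > 0" and "coprime u (int p)"
  shows "(\<Sum>v\<in>{0..<int p}. f ((c + u * v) mod int p)) = (\<Sum>s\<in>{0..<int p}. f s)"
proof (rule sum.reindex_bij_betw)
  have "inj_on (\<lambda>v. (c + u * v) mod int p) {0..<int p}"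
  proof (rule inj_onI)
    fix v w assume vw: "v \<in> {0..<int p}" "w \<in> {0..<int p}"
      and eq: "(c + u * v) mod int p = (c + u * w) mod int p"
    from eq have "[v = w] (mod int p)"
      using assms(2) by (simp add: cong_def[symmetric] cong_add_lcancel cong_mult_lcancel)
    then show "v = w"
      using vw by (simp add: cong_def)
  qed
  moreover have "(\<lambda>v. (c + u * v) mod int p) ` {0..<int p} \<subseteq> {0..<int p}"
    using assms(1) by auto
  ultimately show "bij_betw (\<lambda>v. (c + u * v) mod int p) {0..<int p} {0..<int p}"
    unfolding bij_betw_def by (intro conjI endo_inj_surj) auto
qed

text \<open>By Euler's criterion the Legendre symbol of \<open>-1\<close> is \<open>(-1)\<^bsup>(p - 1) / 2\<^esup>\<close>, and the exponent is
  even.\<close>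

lemma prime_1_mod_4_imp_sqrt_minus_1:
  assumes "prime p" and "[p = 1] (mod 4)"
  obtains \<iota> :: int where "[\<iota>\<^sup>2 = -1] (mod int p)"
proof -
  have p4: "p mod 4 = 1"
    using assms(2) by (simp add: cong_def)
  have p2: "p > 2"
    using prime_ge_2_nat[OF assms(1)] p4 by (cases "p = 2") auto
  have "even ((p - 1) div 2)"
    using p4 by presburger
  then have "[Legendre (-1) (int p) = 1] (mod int p)"
    using euler_criterion[OF assms(1) p2, of "-1"] by simp
  moreover have "\<not> [-1 = 1] (mod int p)" "\<not> [0 = 1] (mod int p)"
    using p2 zdvd_imp_le[of "int p" 2] by (auto simp: cong_iff_dvd_diff)
  ultimately have "QuadRes (int p) (-1)"
    by (auto simp: Legendre_def split: if_splits)
  then show ?thesis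
    using that by (auto simp: QuadRes_def)
qed

text \<open>The factors \<open>a + \<iota> b\<close> and \<open>a - \<iota> b\<close> serve as new coordinates \<open>u\<close> and \<open>v\<close>: their sum and
  difference return \<open>2 a\<close> and \<open>2 \<iota> b\<close>, where \<open>2\<close> and \<open>\<iota>\<close> are units modulo \<open>p\<close>.\<close>

lemma sum_two_squares_hyperbolic:
  fixes f :: "int \<Rightarrow> 'a::comm_monoid_add"
  assumes "prime p" and "odd p" and iota: "[\<iota>\<^sup>2 = -1] (mod int p)"
  shows "(\<Sum>a\<in>{0..<int p}. \<Sum>b\<in>{0..<int p}. f ((a\<^sup>2 + b\<^sup>2) mod int p))
           = (\<Sum>u\<in>{0..<int p}. \<Sum>v\<in>{0..<int p}. f (u * v mod int p))"
proof -
  define \<phi> where "\<phi> = (\<lambda>(a, b). ((a + \<iota> * b) mod int p, (a - \<iota> * b) mod int p))"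
  have p0: "p > 0"
    using assms(1) by (simp add: prime_gt_0_nat)
  have cop2: "coprime (2::int) (int p)"
    using assms(2) by simp
  have cop_iota: "coprime \<iota> (int p)"
  proof -
    have "coprime (\<iota>\<^sup>2) (int p)"
      using cong_imp_coprime[OF cong_sym[OF iota]] by simp
    then show ?thesis by simp
  qed
  have "inj_on \<phi> ({0..<int p} \<times> {0..<int p})"
  proof (rule inj_onI, clarify)
    fix a b c d
    assume mem: "a \<in> {0..<int p}" "b \<in> {0..<int p}" "c \<in> {0..<int p}" "d \<in> {0..<int p}"
      and eq: "\<phi> (a, b) = \<phi> (c, d)"
    have plus: "[a + \<iota> * b = c + \<iota> * d] (mod int p)" and minus: "[a - \<iota> * b = c - \<iota> * d] (mod int p)"
      using eq by (auto simp: \<phi>_def cong_def)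
    have "[2 * a = 2 * c] (mod int p)"
      using cong_add[OF plus minus] by simp
    then have "[a = c] (mod int p)"
      using cop2 cong_mult_lcancel by blast
    moreover have "[(2 * \<iota>) * b = (2 * \<iota>) * d] (mod int p)"
      using cong_diff[OF plus minus] by (simp add: algebra_simps)
    then have "[b = d] (mod int p)"
      using cop2 cop_iota cong_mult_lcancel[of "2 * \<iota>" "int p"] by simp
    ultimately show "a = c \<and> b = d"
      using mem by (simp add: cong_def)
  qed
  moreover have "\<phi> ` ({0..<int p} \<times> {0..<int p}) \<subseteq> {0..<int p} \<times> {0..<int p}"
    using p0 by (auto simp: \<phi>_def)
  ultimately have bij: "bij_betw \<phi> ({0..<int p} \<times> {0..<int p}) ({0..<int p} \<times> {0..<int p})"
    unfolding bij_betw_def by (intro conjI endo_inj_surj) auto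
  have prod: "fst (\<phi> z) * snd (\<phi> z) mod int p = ((fst z)\<^sup>2 + (snd z)\<^sup>2) mod int p" for z
  proof -
    obtain a b where z: "z = (a, b)" by force
    have "[(a + \<iota> * b) * (a - \<iota> * b) = a\<^sup>2 - \<iota>\<^sup>2 * b\<^sup>2] (mod int p)"
      by (simp add: algebra_simps power2_eq_square)
    also have "[a\<^sup>2 - \<iota>\<^sup>2 * b\<^sup>2 = a\<^sup>2 - (-1) * b\<^sup>2] (mod int p)"
      by (intro cong_diff cong_mult iota cong_refl)
    finally show ?thesis
      by (simp add: z \<phi>_def cong_def mod_mult_eq)
  qed
  have "(\<Sum>a\<in>{0..<int p}. \<Sum>b\<in>{0..<int p}. f ((a\<^sup>2 + b\<^sup>2) mod int p))
          = (\<Sum>z\<in>{0..<int p} \<times> {0..<int p}. f (fst (\<phi> z) * snd (\<phi> z) mod int p))"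
    by (simp add: sum.cartesian_product prod case_prod_beta)
  also have "\<dots> = (\<Sum>z\<in>{0..<int p} \<times> {0..<int p}. f (fst z * snd z mod int p))"
    by (rule sum.reindex_bij_betw[OF bij, of "\<lambda>z. f (fst z * snd z mod int p)"])
  also have "\<dots> = (\<Sum>u\<in>{0..<int p}. \<Sum>v\<in>{0..<int p}. f (u * v mod int p))"
    by (simp add: sum.cartesian_product case_prod_beta)
  finally show ?thesis .
qed

section \<open>The recursion\<close>

lemma sum_num_sum_squares:
  assumes "prime p"
  shows "(\<Sum>t\<in>{0..<int p}. num_sum_squares j t p) = p ^ j"
proof (induction j)
  case 0
  then show ?case
    using prime_gt_0_nat[OF assms] by (simp add: num_sum_squares_0[OF assms])
next
  case (Suc j)
  have "(\<Sum>t\<in>{0..<int p}. num_sum_squares (Suc j) t p)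
          = (\<Sum>t\<in>{0..<int p}. \<Sum>a\<in>{0..<int p}. num_sum_squares j ((t - a\<^sup>2) mod int p) p)"
    by (intro sum.cong num_sum_squares_Suc[OF assms]) auto
  also have "\<dots> = (\<Sum>a\<in>{0..<int p}. \<Sum>t\<in>{0..<int p}. num_sum_squares j ((t - a\<^sup>2) mod int p) p)"
    by (rule sum.swap)
  also have "\<dots> = (\<Sum>a\<in>{0..<int p}. \<Sum>s\<in>{0..<int p}. num_sum_squares j s p)"
  proof (rule sum.cong[OF refl])
    fix a
    show "(\<Sum>t\<in>{0..<int p}. num_sum_squares j ((t - a\<^sup>2) mod int p) p)
            = (\<Sum>s\<in>{0..<int p}. num_sum_squares j s p)"
      using sum_residues_affine[of p 1 "\<lambda>s. num_sum_squares j s p" "- a\<^sup>2"] prime_gt_0_nat[OF assms]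
      by simp
  qed
  also have "\<dots> = p ^ Suc j"
    by (simp add: Suc.IH)
  finally show ?case .
qed

text \<open>In the hyperbolic coordinates, \<open>u = 0\<close> leaves the target \<open>t\<close> unchanged, while any other \<open>u\<close>
  is a unit, so \<open>t - u v\<close> is equidistributed as \<open>v\<close> varies.\<close>

lemma num_sum_squares_add_2:
  assumes "prime p" and "odd p" and "[p = 1] (mod 4)" and t: "t \<in> {0..<int p}"
  shows "num_sum_squares (j + 2) t p = p * num_sum_squares j t p + (p - 1) * p ^ j"
proof -
  define N where "N = (\<lambda>s. num_sum_squares j (s mod int p) p)"
  have p0: "p > 0"
    using assms(1) by (simp add: prime_gt_0_nat)
  obtain \<iota> where iota: "[\<iota>\<^sup>2 = -1] (mod int p)"
    using prime_1_mod_4_imp_sqrt_minus_1[OF assms(1,3)] .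
  have "num_sum_squares (j + 2) t p
          = (\<Sum>a\<in>{0..<int p}. num_sum_squares (Suc j) ((t - a\<^sup>2) mod int p) p)"
    using num_sum_squares_Suc[OF assms(1) t, of "Suc j"] by simp
  also have "\<dots> = (\<Sum>a\<in>{0..<int p}. \<Sum>b\<in>{0..<int p}. N (t - (a\<^sup>2 + b\<^sup>2) mod int p))"
    using p0 by (simp add: num_sum_squares_Suc[OF assms(1)] N_def mod_simps diff_diff_eq)
  also have "\<dots> = (\<Sum>u\<in>{0..<int p}. \<Sum>v\<in>{0..<int p}. N (t - u * v mod int p))"
    by (rule sum_two_squares_hyperbolic[OF assms(1,2) iota])
  also have "\<dots> = (\<Sum>u\<in>{0..<int p}. if u = 0 then p * num_sum_squares j t p else p ^ j)"
  proof (rule sum.cong[OF refl])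
    fix u assume u: "u \<in> {0..<int p}"
    show "(\<Sum>v\<in>{0..<int p}. N (t - u * v mod int p))
            = (if u = 0 then p * num_sum_squares j t p else p ^ j)"
    proof (cases "u = 0")
      case True
      then show ?thesis
        using t by (simp add: N_def)
    next
      case False
      then have "\<not> int p dvd u"
        using u zdvd_not_zless[of u "int p"] by auto
      then have "coprime (- u) (int p)"
        using assms(1) prime_imp_coprime[of "int p" u] by (simp add: coprime_commute)
      from sum_residues_affine[OF p0 this, of "\<lambda>s. num_sum_squares j s p" t]
      show ?thesis
        using False by (simp add: N_def mod_simps sum_num_sum_squares[OF assms(1)])
    qed
  qed
  also have "\<dots> = p * num_sum_squares j t p + (\<Sum>u\<in>{0..<int p} - {0}. p ^ j)"
    using p0 by (subst sum.remove[of _ 0]) auto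
  also have "(\<Sum>u\<in>{0..<int p} - {0}. p ^ j) = (p - 1) * p ^ j"
    using p0 by simp
  finally show ?thesis .
qed

section \<open>Square roots and odd numbers of squares\<close>

text \<open>If \<open>y\<close> is one root of \<open>t\<close>, the roots are \<open>y\<close> and \<open>-y\<close>, and these coincide only for
  \<open>t = 0\<close> because \<open>p\<close> is odd.\<close>

lemma num_sum_squares_1:
  assumes "prime p" and "odd p" and t: "t \<in> {0..<int p}"
  shows "num_sum_squares 1 t p = (if t = 0 then 1 else if QuadRes (int p) t then 2 else 0)"
proof -
  have p0: "p > 0" and primep: "prime (int p)"
    using assms(1) by (simp_all add: prime_gt_0_nat)
  have "num_sum_squares 1 t p = (\<Sum>a\<in>{0..<int p}. if a\<^sup>2 mod int p = t then 1 else 0)"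
  proof -
    have "(t - a\<^sup>2) mod int p = 0 \<longleftrightarrow> a\<^sup>2 mod int p = t" for a
      using t by (metis atLeastLessThan_iff mod_eq_dvd_iff mod_eq_0_iff_dvd mod_pos_pos_trivial)
    then show ?thesis
      using num_sum_squares_Suc[OF assms(1) t, of 0] by (simp add: num_sum_squares_0[OF assms(1)])
  qed
  also have "\<dots> = card {a \<in> {0..<int p}. a\<^sup>2 mod int p = t}"
    by (simp add: sum.If_cases Int_def)
  also have "\<dots> = (if t = 0 then 1 else if QuadRes (int p) t then 2 else 0)"
  proof (cases "QuadRes (int p) t")
    case False
    have "t \<noteq> 0"
      using False unfolding QuadRes_def by (metis cong_refl zero_power2)
    moreover have no_roots: "{a \<in> {0..<int p}. a\<^sup>2 mod int p = t} = {}"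
      using False t by (auto simp: QuadRes_def cong_def)
    ultimately show ?thesis
      unfolding no_roots using False by simp
  next
    case True
    then obtain y where y: "[y\<^sup>2 = t] (mod int p)"
      by (auto simp: QuadRes_def)
    have "a\<^sup>2 mod int p = t \<longleftrightarrow> [a = y] (mod int p) \<or> [a = - y] (mod int p)" for a
    proof -
      have "a\<^sup>2 mod int p = t \<longleftrightarrow> [a\<^sup>2 = y\<^sup>2] (mod int p)"
        using y t by (simp add: cong_def)
      also have "\<dots> \<longleftrightarrow> int p dvd (a - y) * (a + y)"
        by (simp add: cong_iff_dvd_diff algebra_simps power2_eq_square)
      also have "\<dots> \<longleftrightarrow> [a = y] (mod int p) \<or> [a = - y] (mod int p)"
        using primep by (simp add: prime_dvd_mult_iff cong_iff_dvd_diff)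
      finally show ?thesis .
    qed
    then have "{a \<in> {0..<int p}. a\<^sup>2 mod int p = t}
                 = {a \<in> {0..<int p}. [a = y] (mod int p) \<or> [a = - y] (mod int p)}"
      by (simp only:)
    also have "\<dots> = {y mod int p, (- y) mod int p}"
      using p0 by (auto simp: cong_def)
    finally have roots: "{a \<in> {0..<int p}. a\<^sup>2 mod int p = t} = {y mod int p, (- y) mod int p}" .
    have "y mod int p = (- y) mod int p \<longleftrightarrow> int p dvd 2 * y"
      by (simp add: mod_eq_dvd_iff)
    also have "\<dots> \<longleftrightarrow> int p dvd y"
      using assms(2) by (simp add: coprime_dvd_mult_right_iff)
    also have "\<dots> \<longleftrightarrow> int p dvd y\<^sup>2"
      using primep by (simp add: prime_dvd_power_iff)
    also have "\<dots> \<longleftrightarrow> t = 0"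
      using y t by (simp add: cong_def dvd_eq_mod_eq_0)
    finally have double: "y mod int p = (- y) mod int p \<longleftrightarrow> t = 0" .
    have "card {r, s} = (if r = s then 1 else 2)" for r s :: int
      by simp
    then show ?thesis
      using True by (simp only: roots double if_True)
  qed
  finally show ?thesis .
qed

text \<open>The recursion of \<open>num_sum_squares_add_2\<close> preserves the shape \<open>p\<^sup>2\<^sup>m + c p\<^sup>m\<close>, with the constant
  \<open>c\<close> one less than the number of square roots of \<open>t\<close>.\<close>

lemma num_sum_squares_odd:
  assumes "prime p" and "odd p" and "[p = 1] (mod 4)" and t: "t \<in> {0..<int p}"
  shows "int (num_sum_squares (2 * m + 1) t p)
           = int p ^ (2 * m) + (int (num_sum_squares 1 t p) - 1) * int p ^ m"
proof (induction m)
  case 0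
  then show ?case by simp
next
  case (Suc m)
  have "int (num_sum_squares (2 * Suc m + 1) t p)
          = int (num_sum_squares ((2 * m + 1) + 2) t p)"
    by simp
  also have "\<dots> = int p * int (num_sum_squares (2 * m + 1) t p) + (int p - 1) * int p ^ (2 * m + 1)"
    unfolding num_sum_squares_add_2[OF assms]
    using prime_gt_0_nat[OF assms(1)] by (simp add: of_nat_diff)
  also have "\<dots> = int p ^ (2 * Suc m) + (int (num_sum_squares 1 t p) - 1) * int p ^ Suc m"
    unfolding Suc.IH by (simp add: algebra_simps)
  finally show ?case .
qed

theorem theorem1p5:
  fixes p m :: nat and t :: int
  assumes "prime p" and "odd p" and "[p = 1] (mod 4)"
    and "t \<in> carrier (residue_ring (int p))"
  shows "(t = \<zero>\<^bsub>residue_ring (int p)\<^esub> \<longrightarrow>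
            int (num_sum_squares (2 * m + 1) t p) = int p ^ (2 * m)) \<and>
         (is_nonresidue p t \<longrightarrow>
            int (num_sum_squares (2 * m + 1) t p) = int p ^ (2 * m) - int p ^ m) \<and>
         (is_residue p t \<longrightarrow>
            int (num_sum_squares (2 * m + 1) t p) = int p ^ (2 * m) + int p ^ m)"
proof -
  have t: "t \<in> {0..<int p}"
    using assms(4) carrier_residue_ring by simp
  have zero: "\<zero>\<^bsub>residue_ring (int p)\<^esub> = 0"
    by (simp add: residue_ring_def)
  have "t \<noteq> 0" if "is_nonresidue p t"
    using that unfolding is_nonresidue_def QuadRes_def by (metis cong_refl zero_power2)
  then show ?thesis
    using num_sum_squares_odd[OF assms(1-3) t, of m] num_sum_squares_1[OF assms(1,2) t]
    by (auto simp: zero is_residue_def is_nonresidue_def)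
qed

end
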